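(* Let $d\ge1$ and let $P\subset\mathbb{R}^d$ be a full-dimensional perfectly centered polytope with dual $P^*$. Then for every $\alpha>0$ the polytope $P+\alpha P^*$ (a Nesterov rounding of $P$) is also perfectly centered.
   Context: $+$ denotes Minkowski sum. For a nonempty face $F$ of a polytope $P\subset\mathbb{R}^d$, the outer normal cone $\mathcal{N}(F;P)$ is the set of $c\in\mathbb{R}^d$ such that $F$ is exactly the set of maximizers of $\langle\cdot,c\rangle$ over $P$. A full-dimensional polytope $P\subset\mathbb{R}^d$ is perfectly centered if $\mathrm{relint}(F)\cap\mathcal{N}(F;P)\neq\emptyset$ for every nonempty face $F$ of $P$ (including $F=P$, where $\mathcal{N}(P;P)=\{0\}$, so the origin is in the interior of $P$). The dual is $P^*=\{x:\langle x,y\rangle\le1\ \forall y\in P\}$. For $\alpha>0$, the Minkowski sum $P+\alpha P^*$ is called a Nesterov rounding of $P$. *)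

theory Defs
  imports "HOL-Analysis.Analysis" "HOL-Library.Set_Algebras"
begin

(* Relatively open cone: the set of maximizers is exactly F, not merely a superset of F. *)
definition outer_normal_cone :: "'a::euclidean_space set \<Rightarrow> 'a set \<Rightarrow> 'a set" where
  "outer_normal_cone F P = {c. F = {x \<in> P. \<forall>y\<in>P. y \<bullet> c \<le> x \<bullet> c}}"

(* The empty set is a face in the sense of face_of, so it is excluded explicitly. *)
definition perfectly_centered :: "'a::euclidean_space set \<Rightarrow> bool" where
  "perfectly_centered P \<longleftrightarrow>
     polytope P \<and> aff_dim P = int DIM('a) \<and>
     (\<forall>F. F face_of P \<and> F \<noteq> {} \<longrightarrow> rel_interior F \<inter> outer_normal_cone F P \<noteq> {})"

definition dual_polytope :: "'a::euclidean_space set \<Rightarrow> 'a set" where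
  "dual_polytope P = {x. \<forall>y\<in>P. x \<bullet> y \<le> 1}"

(* The sum of sets is the elementwise (Minkowski) sum of Set_Algebras. *)
definition nesterov_rounding :: "real \<Rightarrow> 'a::euclidean_space set \<Rightarrow> 'a set" where
  "nesterov_rounding \<alpha> P = P + (\<lambda>x. \<alpha> *\<^sub>R x) ` dual_polytope P"

end

theory Submission
  imports Defs
begin

text \<open>
  Every face of \<open>P\<close> is the set of maximizers of one of its own relatively interior points.
  By induction on the dimension, it follows that for \<open>g\<close> in the relative interior of a face \<open>G\<close>
  all maximizers of \<open>g\<close> over \<open>P\<close> lie in \<open>G\<close>.

  A nonzero functional \<open>c\<close> is a positive multiple of a point \<open>g\<close> in the relative interior of a
  proper face \<open>G\<close> of \<open>P\<close>. The maximizers of \<open>c\<close> over \<open>P\<close> form a face \<open>F \<subseteq> G\<close>, and those over the dual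
  form the face \<open>D\<close> dual to \<open>G\<close>, so that \<open>F + \<alpha> D\<close> is a typical proper face of the Nesterov rounding.
  If \<open>p\<close> and \<open>r\<close> are the centers of \<open>F\<close> and \<open>G\<close>, then \<open>q = r / (r \<bullet> r)\<close> is in the relative interior
  of \<open>D\<close>, and \<open>p + \<alpha> q\<close> is a center of \<open>F + \<alpha> D\<close>: over \<open>P\<close> the maximizers of \<open>p\<close> and \<open>q\<close> are
  \<open>F\<close> and \<open>G\<close>, with intersection \<open>F\<close>; over the dual, the maximizers of \<open>q\<close> are \<open>D\<close>,
  and those of \<open>p\<close> contain \<open>D\<close> because \<open>p \<in> G\<close>.
\<close>

section \<open>Maximizer sets of linear functionals\<close>

definition maximizers :: "'a::euclidean_space set \<Rightarrow> 'a \<Rightarrow> 'a set" where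
  "maximizers S c = {x \<in> S. \<forall>y\<in>S. y \<bullet> c \<le> x \<bullet> c}"

text \<open>Turns membership in a normal cone into an equation between sets, which the calculus of
  \<open>maximizers\<close> can establish.\<close>

lemma outer_normal_cone_iff: "c \<in> outer_normal_cone F P \<longleftrightarrow> maximizers P c = F"
  by (auto simp: outer_normal_cone_def maximizers_def)

lemma maximizers_zero [simp]: "maximizers S 0 = S"
  by (auto simp: maximizers_def)

lemma maximizers_scaleR: "0 < t \<Longrightarrow> maximizers S (t *\<^sub>R c) = maximizers S c"
  by (auto simp: maximizers_def)

text \<open>A common maximizer makes the maximum of the sum equal to the sum of the maxima, so a
  maximizer of \<open>a + b\<close> can fall short in neither summand.\<close>

lemma maximizers_add:
  assumes "maximizers S a \<inter> maximizers S b \<noteq> {}"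
  shows "maximizers S (a + b) = maximizers S a \<inter> maximizers S b"
proof
  obtain z where z: "z \<in> S" "\<And>y. y \<in> S \<Longrightarrow> y \<bullet> a \<le> z \<bullet> a" "\<And>y. y \<in> S \<Longrightarrow> y \<bullet> b \<le> z \<bullet> b"
    using assms by (auto simp: maximizers_def)
  show "maximizers S (a + b) \<subseteq> maximizers S a \<inter> maximizers S b"
  proof
    fix x assume "x \<in> maximizers S (a + b)"
    then have x: "x \<in> S" "z \<bullet> a + z \<bullet> b \<le> x \<bullet> a + x \<bullet> b"
      using z(1) by (auto simp: maximizers_def inner_add_right)
    then have "x \<bullet> a = z \<bullet> a" "x \<bullet> b = z \<bullet> b"
      using z(2)[of x] z(3)[of x] by linarith+
    then show "x \<in> maximizers S a \<inter> maximizers S b"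
      using x z by (auto simp: maximizers_def)
  qed
qed (auto simp: maximizers_def inner_add_right intro: add_mono)

lemma maximizers_nonempty:
  assumes "compact S" "S \<noteq> {}"
  shows "maximizers S c \<noteq> {}"
proof -
  have "continuous_on S (\<lambda>x. x \<bullet> c)"
    by (intro continuous_intros)
  then show ?thesis
    using continuous_attains_sup[OF assms] by (fastforce simp: maximizers_def)
qed

lemma maximizers_face_of:
  assumes "convex S"
  shows "maximizers S c face_of S"
proof (cases "maximizers S c = {}")
  case False
  then obtain z where z: "z \<in> S" "\<And>y. y \<in> S \<Longrightarrow> y \<bullet> c \<le> z \<bullet> c"
    by (auto simp: maximizers_def)
  then have "maximizers S c = {x \<in> S. x \<bullet> c = z \<bullet> c}"
    by (auto simp: maximizers_def intro: order_antisym)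
  then have "maximizers S c = S \<inter> {x. c \<bullet> x = c \<bullet> z}"
    by (auto simp: inner_commute)
  then show ?thesis
    using face_of_Int_supporting_hyperplane_le[OF assms, of c "c \<bullet> z"] z(2)
    by (simp add: inner_commute)
qed simp

text \<open>Faces of polyhedra are exposed; a point of \<open>F\<close> shows that the bound of the
  supporting hyperplane is attained, hence is the maximum.\<close>

lemma face_of_polytope_maximizers:
  assumes "polytope S" "F face_of S" "F \<noteq> {}"
  obtains c where "F = maximizers S c"
proof -
  obtain a b where ab: "S \<subseteq> {x. a \<bullet> x \<le> b}" "F = S \<inter> {x. a \<bullet> x = b}"
    using assms exposed_face_of_polyhedron[of S F] polytope_imp_polyhedron[of S]
    unfolding exposed_face_of_def by blast
  obtain z where "z \<in> S" "a \<bullet> z = b"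
    using ab assms by blast
  then have "F = maximizers S a"
    using ab by (auto simp: maximizers_def inner_commute[of _ a] subset_iff intro: order_antisym)
  then show ?thesis ..
qed

lemma maximizers_sum:
  assumes "maximizers S c \<noteq> {}" "maximizers T c \<noteq> {}"
  shows "maximizers (S + T) c = maximizers S c + maximizers T c"
proof
  obtain s where s: "s \<in> S" "\<And>y. y \<in> S \<Longrightarrow> y \<bullet> c \<le> s \<bullet> c"
    using assms(1) by (auto simp: maximizers_def)
  obtain t where t: "t \<in> T" "\<And>y. y \<in> T \<Longrightarrow> y \<bullet> c \<le> t \<bullet> c"
    using assms(2) by (auto simp: maximizers_def)
  show "maximizers (S + T) c \<subseteq> maximizers S c + maximizers T c"
  proof
    fix x assume x: "x \<in> maximizers (S + T) c"
    then obtain a b where ab: "x = a + b" "a \<in> S" "b \<in> T"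
      by (auto simp: maximizers_def elim: set_plus_elim)
    have "s + t \<in> S + T"
      using s t by (auto intro: set_plus_intro)
    with x have "s \<bullet> c + t \<bullet> c \<le> a \<bullet> c + b \<bullet> c"
      by (simp add: maximizers_def ab(1) flip: inner_add_left)
    then have "a \<bullet> c = s \<bullet> c" "b \<bullet> c = t \<bullet> c"
      using s(2)[OF ab(2)] t(2)[OF ab(3)] by linarith+
    then have "a \<in> maximizers S c" "b \<in> maximizers T c"
      using ab s t by (auto simp: maximizers_def)
    then show "x \<in> maximizers S c + maximizers T c"
      by (auto simp: ab(1) intro: set_plus_intro)
  qed
  show "maximizers S c + maximizers T c \<subseteq> maximizers (S + T) c"
    by (auto simp: maximizers_def inner_add_left elim!: set_plus_elim intro!: set_plus_intro add_mono)
qed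

lemma maximizers_scaleR_image:
  assumes "0 < t"
  shows "maximizers ((*\<^sub>R) t ` S) c = (*\<^sub>R) t ` maximizers S c"
  using assms by (auto simp: maximizers_def)

section \<open>Sums of polytopes and the face around a point\<close>

lemma polytope_set_plus:
  assumes "polytope S" "polytope T"
  shows "polytope (S + T)"
proof -
  have "linear (\<lambda>(x::'a, y). x + y)"
    by (intro linearI) (auto simp: algebra_simps)
  then show ?thesis
    unfolding set_plus_image using assms by (intro polytope_linear_image polytope_Times)
qed

text \<open>A point outside the relative interior lies on a proper face, which has smaller
  dimension; descending through faces must end.\<close>

lemma polytope_rel_interior_face:
  fixes S :: "'a::euclidean_space set"
  assumes "polytope S" "x \<in> S"
  obtains F where "F face_of S" "x \<in> rel_interior F"
proof -
  have "polytope S \<longrightarrow> x \<in> S \<longrightarrow> (\<exists>F. F face_of S \<and> x \<in> rel_interior F)"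
  proof (induction "nat (aff_dim S)" arbitrary: S rule: less_induct)
    case less
    show ?case
    proof (intro impI)
      assume S: "polytope S" "x \<in> S"
      show "\<exists>F. F face_of S \<and> x \<in> rel_interior F"
      proof (cases "x \<in> rel_interior S")
        case True
        then show ?thesis
          using S face_of_refl polytope_imp_convex by blast
      next
        case False
        then have "x \<in> rel_frontier S"
          using S closure_subset by (auto simp: rel_frontier_def)
        then obtain H where H: "H face_of S" "H \<noteq> S" "x \<in> H"
          using rel_frontier_of_polyhedron_alt[OF polytope_imp_polyhedron[OF S(1)]] by blast
        have "aff_dim H < aff_dim S"
          using face_of_aff_dim_lt[OF polytope_imp_convex[OF S(1)] H(1,2)] .
        \<comment> \<open>\<open>nat\<close> sends the dimension -1 of the empty set to 0, so the
          strict decrease after \<open>nat\<close> needs \<open>H\<close> nonempty.\<close>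
        moreover have "\<not> aff_dim H < 0"
          using H(3) aff_dim_negative_iff by blast
        ultimately have "nat (aff_dim H) < nat (aff_dim S)"
          by linarith
        then obtain F where "F face_of H" "x \<in> rel_interior F"
          using less[of H] H S face_of_polytope_polytope by auto
        then show ?thesis
          using H(1) face_of_trans by blast
      qed
    qed
  qed
  then show ?thesis
    using assms that by blast
qed

section \<open>Perfectly centered polytopes\<close>

lemma perfectly_centeredD:
  assumes "perfectly_centered P" "F face_of P" "F \<noteq> {}"
  obtains p where "p \<in> rel_interior F" "maximizers P p = F"
  using assms unfolding perfectly_centered_def by (force simp flip: outer_normal_cone_iff)

text \<open>The center \<open>p\<close> of \<open>P\<close> maximizes its own functional over
  \<open>P\<close>; being interior, it could be pushed further along its own direction unless it is
  0.\<close>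

lemma perfectly_centered_zero_interior:
  fixes P :: "'a::euclidean_space set"
  assumes "perfectly_centered P"
  shows "0 \<in> interior P"
proof -
  have P: "polytope P" "aff_dim P = int DIM('a)"
    using assms by (auto simp: perfectly_centered_def)
  have int: "rel_interior P = interior P"
    using P(2) by (simp add: rel_interior_interior aff_dim_eq_full)
  have "P \<noteq> {}"
    using P(2) by auto
  then obtain p where p: "p \<in> interior P" "maximizers P p = P"
    using perfectly_centeredD[OF assms face_of_refl] P(1) int polytope_imp_convex by metis
  have "p = 0"
  proof (rule ccontr)
    assume "p \<noteq> 0"
    obtain e where e: "e > 0" "cball p e \<subseteq> P"
      using p(1) mem_interior_cball by blast
    define y where "y = p + (e / norm p) *\<^sub>R p"
    have "y \<in> P"
      using e \<open>p \<noteq> 0\<close> by (auto simp: y_def dist_norm subset_iff)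
    moreover have "p \<in> maximizers P p"
      using p interior_subset by blast
    ultimately have "y \<bullet> p \<le> p \<bullet> p"
      by (auto simp: maximizers_def)
    then have "e / norm p * (p \<bullet> p) \<le> 0"
      by (simp add: y_def inner_add_left)
    moreover have "0 < e / norm p * (p \<bullet> p)"
      using e(1) \<open>p \<noteq> 0\<close> by simp
    ultimately show False
      by linarith
  qed
  then show ?thesis
    using p by simp
qed

text \<open>The ray from the center \<open>p\<close> of \<open>G\<close> through \<open>g\<close>
  leaves \<open>G\<close> at a point \<open>g'\<close> of a smaller face \<open>K\<close>. By
  induction the maximizers of \<open>g'\<close> lie in \<open>K\<close>, hence in \<open>G\<close>,
  the maximizer set of \<open>p\<close>. As \<open>g\<close> is a positive combination of
  \<open>g'\<close> and \<open>p\<close>, it has the same maximizers as \<open>g'\<close>.\<close>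

lemma maximizers_subset_face:
  assumes P: "perfectly_centered P"
    and "G face_of P" "g \<in> rel_interior G"
  shows "maximizers P g \<subseteq> G"
  using assms(2,3)
proof (induction "nat (aff_dim G)" arbitrary: G g rule: less_induct)
  case less
  have poly: "polytope P"
    using P by (simp add: perfectly_centered_def)
  have polyG: "polytope G"
    using face_of_polytope_polytope[OF poly less.prems(1)] .
  have gG: "g \<in> G"
    using less.prems(2) rel_interior_subset by blast
  then obtain p where p: "p \<in> rel_interior G" "maximizers P p = G"
    using perfectly_centeredD[OF P less.prems(1)] by blast
  show ?case
  proof (cases "g = p")
    case True
    then show ?thesis
      using p by simp
  next
    case False
    have "p \<in> G"
      using p(1) rel_interior_subset by blast
    \<comment> \<open>The direction must stay in the affine hull for its ray to meet the relative
      frontier.\<close>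
    have "g + 1 *\<^sub>R (g - p) \<in> affine hull G"
      using mem_affine_3_minus[of "affine hull G" g g p 1] gG \<open>p \<in> G\<close> by (simp add: hull_inc)
    then obtain d where d: "0 < d" "g + d *\<^sub>R (g - p) \<in> rel_frontier G"
      using ray_to_rel_frontier[OF polytope_imp_bounded[OF polyG] less.prems(2), of "g - p"] False
      by auto
    define g' where "g' = g + d *\<^sub>R (g - p)"
    obtain H where H: "H face_of G" "H \<noteq> G" "g' \<in> H"
      using d(2) rel_frontier_of_polyhedron_alt[OF polytope_imp_polyhedron[OF polyG]]
      unfolding g'_def by blast
    obtain K where K: "K face_of H" "g' \<in> rel_interior K"
      using polytope_rel_interior_face[OF face_of_polytope_polytope[OF polyG H(1)] H(3)] .
    have "aff_dim K \<le> aff_dim H" "K \<noteq> {}"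
      using K by (auto simp: aff_dim_subset face_of_imp_subset)
    then have "nat (aff_dim K) < nat (aff_dim G)"
      using face_of_aff_dim_lt[OF polytope_imp_convex[OF polyG] H(1,2)] aff_dim_negative_iff[of K]
      by linarith
    moreover have KG: "K face_of G"
      using K(1) H(1) face_of_trans by blast
    ultimately have "maximizers P g' \<subseteq> K"
      using less K(2) face_of_trans by blast
    then have sub: "maximizers P g' \<subseteq> G"
      using KG face_of_imp_subset by blast
    have "maximizers P g' \<noteq> {}"
      using maximizers_nonempty[OF polytope_imp_compact[OF poly]] gG less.prems(1)
        face_of_imp_subset by blast
    then have "maximizers P (g' + d *\<^sub>R p) = maximizers P g' \<inter> G"
      using sub maximizers_add[of P g' "d *\<^sub>R p"] d(1) p(2)
      by (simp add: maximizers_scaleR Int_absorb2)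
    moreover have "g' + d *\<^sub>R p = (1 + d) *\<^sub>R g"
      by (simp add: g'_def algebra_simps)
    ultimately show ?thesis
      using maximizers_scaleR[of "1 + d" P g] d(1) by auto
  qed
qed

section \<open>The dual polytope and its faces\<close>

lemma dual_polytope_convex_hull:
  "dual_polytope (convex hull V) = {x. \<forall>v\<in>V. x \<bullet> v \<le> 1}"
proof -
  have "convex hull V \<subseteq> {y. x \<bullet> y \<le> 1}" if "\<forall>v\<in>V. x \<bullet> v \<le> 1" for x
    using that by (intro hull_minimal) (auto simp: convex_halfspace_le)
  then show ?thesis
    by (auto simp: dual_polytope_def hull_inc)
qed

text \<open>Finitely many generators of \<open>P\<close> give finitely many half-spaces; a ball of
  radius \<open>e\<close> inside \<open>P\<close> bounds the norms in the dual by
  \<open>1 / e\<close>.\<close>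

lemma polytope_dual:
  fixes P :: "'a::euclidean_space set"
  assumes "polytope P" "0 \<in> interior P"
  shows "polytope (dual_polytope P)"
proof -
  obtain V where V: "finite V" "P = convex hull V"
    using assms(1) by (auto simp: polytope_def)
  have "dual_polytope P = \<Inter> ((\<lambda>v. {x. v \<bullet> x \<le> 1}) ` V)"
    by (auto simp: V(2) dual_polytope_convex_hull inner_commute)
  then have "polyhedron (dual_polytope P)"
    using V(1) by (auto intro!: polyhedron_Inter simp: polyhedron_halfspace_le)
  moreover obtain e where e: "e > 0" "cball 0 e \<subseteq> P"
    using assms(2) mem_interior_cball by blast
  have "norm x \<le> 1 / e" if "x \<in> dual_polytope P" for x
  proof (cases "x = 0")
    case False
    have "(e / norm x) *\<^sub>R x \<in> P"
      using e False by (auto simp: subset_iff)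
    then have "x \<bullet> ((e / norm x) *\<^sub>R x) \<le> 1"
      using that by (auto simp: dual_polytope_def)
    then have "e * norm x \<le> 1"
      using False by (simp add: power2_eq_square flip: power2_norm_eq_inner)
    then show ?thesis
      using e by (simp add: field_simps)
  qed (use e in simp)
  then have "bounded (dual_polytope P)"
    by (auto simp: bounded_iff)
  ultimately show ?thesis
    by (simp add: polytope_eq_bounded_polyhedron)
qed

text \<open>The classical conjugate face: 1 is the largest value the dual allows on
  \<open>P\<close>. It is empty whenever \<open>0 \<in> G\<close>.\<close>

definition dual_face :: "'a::euclidean_space set \<Rightarrow> 'a set \<Rightarrow> 'a set" where
  "dual_face P G = {y \<in> dual_polytope P. \<forall>x\<in>G. y \<bullet> x = 1}"

lemma maximizers_dual_supset:
  assumes "p \<in> G" "p \<in> P"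
  shows "dual_face P G \<subseteq> maximizers (dual_polytope P) p"
  using assms by (auto simp: dual_face_def maximizers_def dual_polytope_def)

text \<open>Nonemptiness of the dual face makes 1 the maximum at \<open>g\<close>. A functional
  bounded by 1 on \<open>G\<close> that reaches 1 at a relatively interior point is constantly 1 on
  \<open>G\<close>.\<close>

lemma maximizers_dual:
  assumes "G \<subseteq> P" "convex G" "g \<in> rel_interior G" "dual_face P G \<noteq> {}"
  shows "maximizers (dual_polytope P) g = dual_face P G"
proof
  have gG: "g \<in> G"
    using assms(3) rel_interior_subset by blast
  then show "dual_face P G \<subseteq> maximizers (dual_polytope P) g"
    using assms(1) by (intro maximizers_dual_supset) auto
  show "maximizers (dual_polytope P) g \<subseteq> dual_face P G"
  proof
    fix y assume y: "y \<in> maximizers (dual_polytope P) g"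
    obtain q where "q \<in> dual_polytope P" "q \<bullet> g = 1"
      using assms(4) gG by (auto simp: dual_face_def)
    with y have yP: "y \<in> dual_polytope P" and "1 \<le> y \<bullet> g"
      by (force simp: maximizers_def)+
    have le: "y \<bullet> x \<le> 1" if "x \<in> G" for x
      using yP that assms(1) by (auto simp: dual_polytope_def)
    have "y \<bullet> x = 1" if x: "x \<in> G" for x
    proof -
      \<comment> \<open>Prolong the segment from \<open>x\<close> beyond \<open>g\<close> inside
        \<open>G\<close>: since \<open>y\<close> is at most 1 at the far end and at least 1 at
        \<open>g\<close>, it is at least 1 at \<open>x\<close>.\<close>
      obtain e where e: "e > 1" "(1 - e) *\<^sub>R x + e *\<^sub>R g \<in> G"
        using convex_rel_interior_iff[OF assms(2)] assms(3) x by blast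
      have "(1 - e) * (y \<bullet> x) + e * (y \<bullet> g) \<le> 1"
        using le[OF e(2)] by (simp add: inner_add_right)
      moreover have "e * 1 \<le> e * (y \<bullet> g)"
        using e(1) \<open>1 \<le> y \<bullet> g\<close> by (intro mult_left_mono) auto
      ultimately have "(e - 1) * 1 \<le> (e - 1) * (y \<bullet> x)"
        by (simp add: algebra_simps)
      then show ?thesis
        using e(1) le[OF x] by (simp add: mult_le_cancel_left)
    qed
    then show "y \<in> dual_face P G"
      using yP by (simp add: dual_face_def)
  qed
qed

text \<open>From any \<open>y\<close> in the dual face one can pass slightly beyond
  \<open>q\<close>: only constraints at generators of \<open>P\<close> outside \<open>G\<close>
  could obstruct this, and they are strict at \<open>q\<close>.\<close>

lemma rel_interior_dual_face:
  assumes P: "polytope P"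
    and q: "q \<in> dual_polytope P" "G = {x \<in> P. q \<bullet> x = 1}"
  shows "q \<in> rel_interior (dual_face P G)"
proof -
  have convex: "convex (dual_face P G)"
  proof -
    have "dual_face P G = (\<Inter>x\<in>P. {y. x \<bullet> y \<le> 1}) \<inter> (\<Inter>x\<in>G. {y. x \<bullet> y = 1})"
      by (auto simp: dual_face_def dual_polytope_def inner_commute)
    then show ?thesis
      by (auto intro!: convex_Int convex_INT convex_halfspace_le convex_hyperplane)
  qed
  have qD: "q \<in> dual_face P G"
    using q by (simp add: dual_face_def)
  obtain V where V: "finite V" "P = convex hull V"
    using P by (auto simp: polytope_def)
  have "\<exists>e>1. (1 - e) *\<^sub>R y + e *\<^sub>R q \<in> dual_face P G" if y: "y \<in> dual_face P G" for y
  proof -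
    \<comment> \<open>The left side is the value at \<open>v\<close> of
      \<open>q + t (q - y)\<close>. On \<open>G\<close> it is constantly 1; elsewhere it starts
      below 1 and is continuous in \<open>t\<close>.\<close>
    have "\<exists>d>0. \<forall>t. 0 < t \<and> t < d \<longrightarrow> q \<bullet> v + t * (q \<bullet> v - y \<bullet> v) \<le> 1"
      if "v \<in> V" for v
    proof (cases "v \<in> G")
      case True
      then show ?thesis
        using qD y by (auto simp: dual_face_def intro!: exI[of _ 1])
    next
      case False
      then have lt: "q \<bullet> v < 1"
        using q that V by (force simp: dual_polytope_def hull_inc)
      have "((\<lambda>t. q \<bullet> v + t * (q \<bullet> v - y \<bullet> v)) \<longlongrightarrow> q \<bullet> v + 0 * (q \<bullet> v - y \<bullet> v)) (at_right 0)"
        by (intro tendsto_intros)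
      then have "\<forall>\<^sub>F t in at_right 0. q \<bullet> v + t * (q \<bullet> v - y \<bullet> v) < 1"
        using lt by (auto dest: order_tendstoD(2))
      then show ?thesis
        by (force simp: eventually_at_right_field)
    qed
    then have "\<forall>v\<in>V. \<forall>\<^sub>F t in at_right 0. q \<bullet> v + t * (q \<bullet> v - y \<bullet> v) \<le> 1"
      by (force simp: eventually_at_right_field)
    \<comment> \<open>Finiteness of \<open>V\<close> yields one step size for all
      generators.\<close>
    then have "\<forall>\<^sub>F t in at_right (0::real). \<forall>v\<in>V. q \<bullet> v + t * (q \<bullet> v - y \<bullet> v) \<le> 1"
      using V(1) by (simp add: eventually_ball_finite)
    then obtain d :: real where "d > 0"
      "\<And>t. 0 < t \<Longrightarrow> t < d \<Longrightarrow> \<forall>v\<in>V. q \<bullet> v + t * (q \<bullet> v - y \<bullet> v) \<le> 1"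
      by (force simp: eventually_at_right_field)
    then obtain t :: real where t: "t > 0" "\<And>v. v \<in> V \<Longrightarrow> q \<bullet> v + t * (q \<bullet> v - y \<bullet> v) \<le> 1"
      using dense by blast
    have "(1 - (1 + t)) *\<^sub>R y + (1 + t) *\<^sub>R q \<in> dual_face P G"
    proof -
      have "(1 - (1 + t)) *\<^sub>R y + (1 + t) *\<^sub>R q \<in> dual_polytope P"
        using t(2) by (auto simp: V(2) dual_polytope_convex_hull inner_add_left algebra_simps)
      then show ?thesis
        using y qD by (auto simp: dual_face_def inner_add_left inner_diff_left algebra_simps)
    qed
    then show ?thesis
      using t(1) by (intro exI[of _ "1 + t"]) simp
  qed
  then show ?thesis
    using convex_rel_interior_iff[OF convex] qD by blast
qed

text \<open>The center \<open>r\<close> of \<open>G\<close>, rescaled to take the value 1 on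
  \<open>G\<close>, lies in the dual and satisfies its constraints with equality exactly on
  \<open>G\<close>.\<close>

lemma perfectly_centered_dual_center:
  assumes P: "perfectly_centered P"
    and G: "G face_of P" "G \<noteq> {}" "G \<noteq> P"
  obtains q where "q \<in> rel_interior (dual_face P G)" "maximizers P q = G"
    "maximizers (dual_polytope P) q = dual_face P G"
proof -
  have poly: "polytope P"
    using P by (simp add: perfectly_centered_def)
  have GP: "G \<subseteq> P" "convex G"
    using G(1) by (auto simp: face_of_imp_subset face_of_imp_convex)
  obtain r where r: "r \<in> rel_interior G" "maximizers P r = G"
    using perfectly_centeredD[OF P G(1,2)] .
  \<comment> \<open>The zero functional is maximized on all of \<open>P\<close>, whereas
    \<open>G\<close> is proper.\<close>
  have "r \<noteq> 0"
    using r(2) G(3) by auto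
  define t where "t = 1 / (r \<bullet> r)"
  have t: "t > 0" "t * (r \<bullet> r) = 1"
    using \<open>r \<noteq> 0\<close> by (auto simp: t_def)
  have "r \<in> G"
    using r(1) rel_interior_subset by blast
  then have rmax: "r \<in> P" "x \<bullet> r \<le> r \<bullet> r" if "x \<in> P" for x
    using r(2) that by (auto simp: maximizers_def)
  have "r \<bullet> x * t \<le> 1" if "x \<in> P" for x
    using mult_left_mono[OF rmax(2)[OF that], of t] t by (simp add: inner_commute mult.commute)
  then have qP: "t *\<^sub>R r \<in> dual_polytope P"
    by (simp add: dual_polytope_def mult.commute)
  have "G = {x \<in> P. x \<bullet> r = r \<bullet> r}"
    using r(2) rmax by (force simp: maximizers_def)
  then have G_eq: "G = {x \<in> P. (t *\<^sub>R r) \<bullet> x = 1}"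
    using \<open>r \<noteq> 0\<close> by (auto simp: t_def inner_commute)
  have int: "t *\<^sub>R r \<in> rel_interior (dual_face P G)"
    using rel_interior_dual_face[OF poly qP G_eq] .
  then have "maximizers (dual_polytope P) r = dual_face P G"
    using maximizers_dual[OF GP r(1)] by fastforce
  then show ?thesis
    using that[OF int] r(2) maximizers_scaleR[OF t(1)] by metis
qed

section \<open>Directions, boundary faces and the Nesterov rounding\<close>

lemma nonzero_direction_face:
  fixes P :: "'a::euclidean_space set"
  assumes P: "polytope P" "0 \<in> interior P" and "c \<noteq> 0"
  obtains t G where "t > 0" "G face_of P" "G \<noteq> P" "t *\<^sub>R c \<in> rel_interior G"
proof -
  obtain t where t: "t > 0" "t *\<^sub>R c \<in> frontier P"
    using ray_to_frontier[OF polytope_imp_bounded[OF P(1)] P(2) \<open>c \<noteq> 0\<close>] by auto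
  then have "t *\<^sub>R c \<in> P" "t *\<^sub>R c \<notin> interior P"
    using polytope_imp_closed[OF P(1)] by (auto simp: frontier_def)
  \<comment> \<open>This keeps the boundary point \<open>t *\<^sub>R c\<close> out of
    \<open>rel_interior P\<close>, so the face around it is proper.\<close>
  moreover have "rel_interior P = interior P"
    using P(2) by (intro rel_interior_nonempty_interior) auto
  ultimately show ?thesis
    using polytope_rel_interior_face[OF P(1)] that t(1) by metis
qed

theorem theorem5:
  fixes P :: "(real ^ 'n) set" and \<alpha> :: real
  assumes "perfectly_centered P" and "\<alpha> > 0"
  shows "perfectly_centered (nesterov_rounding \<alpha> P)"
proof -
  note P = assms(1)
  have poly: "polytope P"
    using P by (simp add: perfectly_centered_def)
  have zero: "0 \<in> interior P"
    using perfectly_centered_zero_interior[OF P] .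
  define D where "D = dual_polytope P"
  define Q where "Q = P + (*\<^sub>R) \<alpha> ` D"
  have polyD: "polytope D"
    unfolding D_def using polytope_dual[OF poly zero] .
  have "0 \<in> D"
    by (simp add: D_def dual_polytope_def)
  have polyQ: "polytope Q"
    unfolding Q_def using poly polyD by (intro polytope_set_plus polytope_scaling)
  have maxQ: "maximizers Q c = maximizers P c + (*\<^sub>R) \<alpha> ` maximizers D c" for c
  proof -
    have "maximizers P c \<noteq> {}"
      using maximizers_nonempty[OF polytope_imp_compact[OF poly]] zero interior_subset by blast
    moreover have "maximizers D c \<noteq> {}"
      using maximizers_nonempty[OF polytope_imp_compact[OF polyD]] \<open>0 \<in> D\<close> by blast
    ultimately show ?thesis
      using assms(2) by (simp add: Q_def maximizers_sum maximizers_scaleR_image)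
  qed
  \<comment> \<open>Through this inclusion \<open>Q\<close> inherits full dimension and 0 as an
    interior point.\<close>
  have "P \<subseteq> Q"
    using \<open>0 \<in> D\<close> unfolding Q_def by (force simp: set_plus_def)
  then have zeroQ: "0 \<in> interior Q"
    using zero interior_mono by blast
  then have dimQ: "aff_dim Q = int DIM(real ^ 'n)"
    by (intro aff_dim_nonempty_interior) auto
  have "rel_interior E \<inter> outer_normal_cone E Q \<noteq> {}" if E: "E face_of Q" "E \<noteq> {}" for E
  proof -
    obtain c where c: "E = maximizers Q c"
      using face_of_polytope_maximizers[OF polyQ E] .
    show ?thesis
    \<comment> \<open>For \<open>c = 0\<close> the face is \<open>Q\<close> itself, with center
      0.\<close>
    proof (cases "c = 0")
      case True
      have "rel_interior Q = interior Q"
        using zeroQ by (intro rel_interior_nonempty_interior) auto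
      then have "0 \<in> rel_interior E \<inter> outer_normal_cone E Q"
        using True c zeroQ by (simp add: outer_normal_cone_iff)
      then show ?thesis
        by blast
    next
      case False
      obtain t G where t: "t > 0" and G: "G face_of P" "G \<noteq> P" "t *\<^sub>R c \<in> rel_interior G"
        using nonzero_direction_face[OF poly zero False] .
      have GP: "G \<subseteq> P" "convex G" "G \<noteq> {}"
        using G by (auto simp: face_of_imp_subset face_of_imp_convex)
      define F where "F = maximizers P c"
      have "F \<subseteq> G"
        using maximizers_subset_face[OF P G(1,3)] t by (simp add: F_def maximizers_scaleR)
      have F: "F face_of P" "F \<noteq> {}"
        unfolding F_def
        using maximizers_face_of[OF polytope_imp_convex[OF poly]]
          maximizers_nonempty[OF polytope_imp_compact[OF poly]] GP by blast+
      obtain p where p: "p \<in> rel_interior F" "maximizers P p = F"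
        using perfectly_centeredD[OF P F] .
      obtain q where q: "q \<in> rel_interior (dual_face P G)" "maximizers P q = G"
        "maximizers D q = dual_face P G"
        using perfectly_centered_dual_center[OF P G(1) GP(3) G(2)] unfolding D_def .
      have ne: "dual_face P G \<noteq> {}"
        using q(1) by auto
      have maxD: "maximizers D c = dual_face P G"
        using maximizers_dual[OF GP(1,2) G(3) ne] t by (simp add: D_def maximizers_scaleR)
      have E_eq: "E = F + (*\<^sub>R) \<alpha> ` dual_face P G"
        by (simp add: c maxQ maxD F_def)
      have "maximizers P (p + \<alpha> *\<^sub>R q) = F"
        using maximizers_add[of P p "\<alpha> *\<^sub>R q"] p(2) q(2) assms(2)
          \<open>F \<subseteq> G\<close> F(2) by (simp add: maximizers_scaleR Int_absorb2)
      moreover have "maximizers D (p + \<alpha> *\<^sub>R q) = dual_face P G"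
      proof -
        have "p \<in> G"
          using p(1) rel_interior_subset \<open>F \<subseteq> G\<close> by blast
        then have "dual_face P G \<subseteq> maximizers D p"
          unfolding D_def using GP(1) by (intro maximizers_dual_supset) auto
        then show ?thesis
          using maximizers_add[of D p "\<alpha> *\<^sub>R q"] q(3) assms(2) ne
          by (simp add: maximizers_scaleR Int_absorb1)
      qed
      ultimately have "p + \<alpha> *\<^sub>R q \<in> outer_normal_cone E Q"
        by (simp add: outer_normal_cone_iff maxQ E_eq)
      moreover have "p + \<alpha> *\<^sub>R q \<in> rel_interior E"
      proof -
        have "convex (dual_face P G)"
          using maximizers_face_of[OF polytope_imp_convex[OF polyD], of c] maxD
          by (simp add: face_of_imp_convex)
        \<comment> \<open>Relative interiors of convex sets commute with Minkowski sums and scaling,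
          so the two centers may be added.\<close>
        then have "rel_interior E = rel_interior F + (*\<^sub>R) \<alpha> ` rel_interior (dual_face P G)"
          unfolding E_eq using F(1) assms(2)
          by (simp add: rel_interior_sum face_of_imp_convex convex_scaling rel_interior_scaleR)
        then show ?thesis
          using p(1) q(1) by (auto intro: set_plus_intro)
      qed
      ultimately show ?thesis
        by blast
    qed
  qed
  then have "perfectly_centered Q"
    using polyQ dimQ by (simp add: perfectly_centered_def)
  then show ?thesis
    by (simp add: nesterov_rounding_def Q_def D_def)
qed

end
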